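(* Fix a positive integer $k$ and a real $\beta\in(0,1)$. For $z\in(0,1]$ let $\beta^{i(z)}$ denote the largest value $\beta^i$, with $i$ a non-negative integer, that is less than $z$. Let $T$ be the threshold choosing function $T(k,A,h)=\beta^{i(m_{k+1})}$, where $m_{k+1}$ is the $(k+1)$-st smallest distinct hash value among the hash values of the identifiers of the stream $A$. Then $T$ satisfies $1$-Goodness: for every stream $A$ on which $T$ is defined (at least $k+1$ distinct identifiers), every distinct identifier $\ell$ of $A$, and every fixed assignment $X^{n_A}_{-\ell}$ of hash values to the other distinct identifiers of $A$, the fix-all-but-one projection $x_\ell\mapsto T_\ell[X^{n_A}_{-\ell}](x_\ell)$ satisfies $1$-Goodness for univariate functions.
   Context: Identifiers come from a universe $[n]$. A stream $A$ is a finite sequence of identifiers (repetitions allowed), and $n_A$ is its number of distinct identifiers. A hash function $h:[n]\to(0,1)$ assigns hash values; $X^{n_A}$ denotes the assignment of hash values to the distinct identifiers of $A$. A threshold choosing function (TCF) maps $k$, a stream $A$ and $h$ to a threshold in $(0,1]$, depending on $h$ only through $X^{n_A}$; for fixed $k,A$ we write $T(X^{n_A})$. Fix-all-but-one projection: for a distinct identifier $\ell$ of $A$ and a fixed assignment $X^{n_A}_{-\ell}$ of hash values to all distinct identifiers of $A$ except $\ell$, $T_\ell[X^{n_A}_{-\ell}](x_\ell):=T(X^{n_A})$ where $X^{n_A}$ combines $X^{n_A}_{-\ell}$ with value $x_\ell$ for $\ell$; it maps $(0,1)\to(0,1]$. A function $f:(0,1)\to(0,1]$ satisfies $1$-Goodness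 if there is a threshold $F$ with: $x<F\Rightarrow f(x)=F$, and $x\ge F\Rightarrow f(x)\le x$.
   Formalization: The (k+1)-st smallest hash value counts one value per distinct identifier, so equal values of different identifiers count separately; with equal values merged, the threshold can be undefined or 1-Goodness can fail when hash values collide. Without collisions the two agree. *)

theory Defs
  imports Complex_Main "HOL-Library.FuncSet"
begin

text \<open>Identifiers are natural numbers from the universe \<open>{1..n}\<close>; a stream is a list of identifiers,
  and \<open>set A\<close> is the set of distinct identifiers of \<open>A\<close>. A hash function is a real-valued function
  with values in \<open>{0<..<1}\<close> at the relevant identifiers.\<close>

type_synonym stream = "nat list"
type_synonym hash = "nat \<Rightarrow> real"

text \<open>The type of threshold choosing functions.\<close>

type_synonym tcf = "nat \<Rightarrow> stream \<Rightarrow> hash \<Rightarrow> real"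

text \<open>The \<open>j\<close>-th smallest hash value of a stream (\<open>j\<close> counts from 1). Each distinct identifier
  contributes its hash value exactly once, however often it is repeated in the stream. Two
  different identifiers with colliding hash values contribute twice, so the value is meaningful
  for every stream with at least \<open>j\<close> distinct identifiers and every hash function.\<close>

definition kth_hash :: "nat \<Rightarrow> stream \<Rightarrow> hash \<Rightarrow> real" where
  "kth_hash j A h = sort (map h (remdups A)) ! (j - 1)"

text \<open>In the absence of collisions this is the \<open>j\<close>-th smallest element of the set of hash values.\<close>

lemma kth_hash_inj:
  assumes "inj_on h (set A)"
  shows "kth_hash j A h = sorted_list_of_set (h ` set A) ! (j - 1)"
proof -
  have "distinct (map h (remdups A))"
    using assms by (simp add: distinct_map)
  then have "sorted_list_of_set (set (map h (remdups A))) = sort (map h (remdups A))"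
    by (simp only: sorted_list_of_set_sort_remdups distinct_remdups_id)
  then show ?thesis
    by (simp add: kth_hash_def)
qed

text \<open>The largest value \<open>\<beta> ^ i\<close> below \<open>z\<close>.\<close>

definition beta_below :: "real \<Rightarrow> real \<Rightarrow> real" where
  "beta_below \<beta> z = (GREATEST y. (\<exists>i::nat. y = \<beta> ^ i) \<and> y < z)"

definition beta_tcf :: "real \<Rightarrow> tcf" where
  "beta_tcf \<beta> k A h = beta_below \<beta> (kth_hash (k + 1) A h)"

text \<open>It depends on the hash function only through the hash values of the identifiers of the
  stream.\<close>

lemma beta_tcf_cong:
  assumes "\<And>i. i \<in> set A \<Longrightarrow> h i = h' i"
  shows "beta_tcf \<beta> k A h = beta_tcf \<beta> k A h'"
proof -
  have "map h (remdups A) = map h' (remdups A)"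
    using assms by simp
  then show ?thesis
    by (simp only: beta_tcf_def kth_hash_def)
qed

text \<open>In the projection, the values of \<open>X\<close> outside \<open>set A - {l}\<close> are irrelevant for a threshold
  choosing function; \<open>X (l := x)\<close> is the full assignment combined from \<open>X\<close> and \<open>x\<close>.\<close>

definition fix_all_but_one :: "tcf \<Rightarrow> nat \<Rightarrow> stream \<Rightarrow> nat \<Rightarrow> hash \<Rightarrow> real \<Rightarrow> real" where
  "fix_all_but_one T k A l X = (\<lambda>x. T k A (X(l := x)))"

text \<open>Univariate 1-Goodness is a property of functions from \<open>{0<..<1}\<close> to \<open>{0<..1}\<close>; the mapping
  property is part of the definition.\<close>

definition one_good :: "(real \<Rightarrow> real) \<Rightarrow> bool" where
  "one_good f \<longleftrightarrow>
     f \<in> {0<..<1} \<rightarrow> {0<..1} \<and>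
     (\<exists>F\<in>{0<..1}. \<forall>x\<in>{0<..<1}. (x < F \<longrightarrow> f x = F) \<and> (F \<le> x \<longrightarrow> f x \<le> x))"

text \<open>1-Goodness of a threshold choosing function at parameter \<open>k\<close>, over the universe \<open>{1..n}\<close>;
  \<open>defd A\<close> says on which streams the function is defined.\<close>

definition tcf_one_good :: "nat \<Rightarrow> nat \<Rightarrow> (stream \<Rightarrow> bool) \<Rightarrow> tcf \<Rightarrow> bool" where
  "tcf_one_good n k defd T \<longleftrightarrow>
     (\<forall>A l X. set A \<subseteq> {1..n} \<longrightarrow> defd A \<longrightarrow> l \<in> set A \<longrightarrow> X \<in> set A - {l} \<rightarrow> {0<..<1} \<longrightarrow>
        one_good (fix_all_but_one T k A l X))"

end

theory Submission
  imports Defs "HOL-Library.Multiset"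
begin

text \<open>Let \<open>a\<close> be the \<open>k\<close>-th smallest hash value of the identifiers other than \<open>l\<close>. Inserting a value
  \<open>x \<le> a\<close> makes \<open>a\<close> the \<open>(k + 1)\<close>-st smallest, whereas inserting \<open>x \<ge> a\<close> makes the \<open>(k + 1)\<close>-st
  smallest at most \<open>x\<close>. So 1-Goodness holds with \<open>F\<close> the largest power of \<open>\<beta>\<close> below \<open>a\<close>: it is
  attained for all \<open>x \<le> a\<close>, in particular for \<open>x < F\<close>, and for \<open>x \<ge> a\<close> the threshold lies below
  the \<open>(k + 1)\<close>-st smallest value, hence below \<open>x\<close>.\<close>

text \<open>Powers of \<open>\<beta>\<close> tend to 0, so some power lies below \<open>z\<close>.
  They decrease in the exponent, so the least such exponent gives the maximum that
  \<open>GREATEST\<close> asks for.\<close>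

lemma beta_below_bounds:
  assumes "0 < \<beta>" "\<beta> < 1" "0 < z"
  shows "0 < beta_below \<beta> z" "beta_below \<beta> z < z"
proof -
  define i where "i = (LEAST i. \<beta> ^ i < z)"
  obtain j where "\<beta> ^ j < z"
    using real_arch_pow_inv assms by blast
  then have i: "\<beta> ^ i < z"
    unfolding i_def by (rule LeastI)
  have "beta_below \<beta> z = \<beta> ^ i"
    unfolding beta_below_def
  proof (rule Greatest_equality)
    show "(\<exists>j. \<beta> ^ i = \<beta> ^ j) \<and> \<beta> ^ i < z"
      using i by blast
    fix y
    assume "(\<exists>j. y = \<beta> ^ j) \<and> y < z"
    then obtain j where "y = \<beta> ^ j" "\<beta> ^ j < z"
      by blast
    moreover from this have "i \<le> j"
      unfolding i_def by (simp add: Least_le)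
    ultimately show "y \<le> \<beta> ^ i"
      using assms by (simp add: power_decreasing)
  qed
  then show "0 < beta_below \<beta> z" "beta_below \<beta> z < z"
    using i assms by simp_all
qed

text \<open>Since \<open>x\<close> lands at or before index \<open>j\<close>, the entry there shifts
  right by one.\<close>

lemma nth_Suc_insort_le:
  fixes x :: "'a::linorder"
  assumes "sorted xs" "j < length xs" "x \<le> xs ! j"
  shows "insort x xs ! Suc j = xs ! j"
  using assms
proof (induction xs arbitrary: j)
  case (Cons a xs)
  then show ?case
    by (cases j) (auto simp: insort_is_Cons dest: nth_mem)
qed simp

text \<open>By sortedness \<open>j + 1\<close> entries of \<open>xs\<close> are at most
  \<open>x\<close>; with \<open>x\<close> itself, \<open>j + 2\<close> are.\<close>

lemma nth_Suc_insort_ge: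
  fixes x :: "'a::linorder"
  assumes "sorted xs" "j < length xs" "xs ! j \<le> x"
  shows "insort x xs ! Suc j \<le> x"
  using assms
proof (induction xs arbitrary: j)
  case (Cons a xs)
  show ?case
  proof (cases j)
    case 0
    with Cons.prems show ?thesis
      by (cases xs) auto
  next
    case (Suc i)
    with Cons show ?thesis
      by auto
  qed
qed simp

text \<open>One list \<open>as\<close>, chosen before \<open>x\<close>, serves all \<open>x\<close>;
  being a list, it keeps colliding hash values.\<close>

lemma sort_hashes_fun_upd:
  assumes "l \<in> set A"
  obtains as where "sorted as" "Suc (length as) = card (set A)" "set as = X ` (set A - {l})"
    "\<And>x. sort (map (X(l := x)) (remdups A)) = insort x as"
proof -
  obtain us vs where uv: "remdups A = us @ l # vs"
    using assms by (metis set_remdups split_list)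
  have dist: "distinct (us @ l # vs)"
    using distinct_remdups[of A] unfolding uv .
  have setA: "set A = set (us @ l # vs)"
    using set_remdups[of A] unfolding uv by simp
  define as where "as = sort (map X (us @ vs))"
  have "sort (map (X(l := x)) (remdups A)) = insort x as" for x
  proof (rule properties_for_sort)
    have "map (X(l := x)) (remdups A) = map X us @ x # map X vs"
      using dist by (simp add: uv)
    then show "mset (insort x as) = mset (map (X(l := x)) (remdups A))"
      by (simp add: as_def)
    show "sorted (insort x as)"
      by (simp add: as_def sorted_insort)
  qed
  moreover have "sorted as"
    by (simp add: as_def)
  moreover have "Suc (length as) = card (set A)"
    using distinct_card[OF dist] setA by (simp add: as_def)
  moreover have "set as = X ` (set A - {l})"
    using dist setA by (auto simp: as_def)
  ultimately show thesis
    using that by blast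
qed

theorem theorem7:
  fixes n k :: nat and \<beta> :: real
  assumes "0 < k" and "0 < \<beta>" and "\<beta> < 1"
  shows "tcf_one_good n k (\<lambda>A. k + 1 \<le> card (set A)) (beta_tcf \<beta>)"
  unfolding tcf_one_good_def
proof (intro allI impI)
  fix A :: stream and l X
  assume card: "k + 1 \<le> card (set A)" and l: "l \<in> set A"
    and X: "X \<in> set A - {l} \<rightarrow> {0<..<1::real}"
  obtain as where as: "sorted as" "Suc (length as) = card (set A)" "set as = X ` (set A - {l})"
    "\<And>x. sort (map (X(l := x)) (remdups A)) = insort x as"
    using sort_hashes_fun_upd[OF l] by metis
  define f where "f = fix_all_but_one (beta_tcf \<beta>) k A l X"
  \<comment> \<open>Index \<open>j = k - 1\<close> holds the \<open>k\<close>-th smallest of the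
    other hash values.\<close>
  obtain j where j: "k = Suc j" "j < length as"
    using assms(1) card as(2) by (cases k) auto
  have range_as: "set as \<subseteq> {0<..<1}"
    using X as(3) by auto
  define a where "a = as ! j"
  have a: "0 < a" "a < 1"
    using range_as nth_mem[OF j(2)] by (auto simp: a_def)
  have f: "f x = beta_below \<beta> (insort x as ! k)" for x
    by (simp add: f_def fix_all_but_one_def beta_tcf_def kth_hash_def as(4) del: fun_upd_apply)
  have range: "0 < insort x as ! k" "insort x as ! k < 1" if "x \<in> {0<..<1}" for x
  proof -
    have "insort x as ! k \<in> set (insort x as)"
      using j by (intro nth_mem) simp
    then show "0 < insort x as ! k" "insort x as ! k < 1"
      using that range_as by (auto simp: set_insort_key)
  qed
  note below = beta_below_bounds[OF assms(2,3)]
  define F where "F = beta_below \<beta> a"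
  have F: "0 < F" "F < a"
    using below a by (simp_all add: F_def)
  have f_le: "f x = F" if "x \<le> a" for x
    using nth_Suc_insort_le[OF as(1) j(2)] that by (simp add: f j(1) a_def F_def)
  have f_ge: "f x \<le> x" if "a \<le> x" "x \<in> {0<..<1}" for x
    using nth_Suc_insort_ge[OF as(1) j(2), of x] below(2)[OF range(1)[OF that(2)]] that(1)
    by (simp add: f j(1) a_def)
  have "f \<in> {0<..<1} \<rightarrow> {0<..1}"
  proof
    fix x :: real
    assume x: "x \<in> {0<..<1}"
    show "f x \<in> {0<..1}"
      using below[OF range(1)[OF x]] range(2)[OF x] by (simp add: f)
  qed
  \<comment> \<open>Splitting at \<open>a\<close> instead of \<open>F\<close> works: for
    \<open>F \<le> x \<le> a\<close> the value \<open>F\<close> is at most \<open>x\<close>, and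
    \<open>x > a\<close> excludes \<open>x < F\<close>.\<close>
  moreover have "(x < F \<longrightarrow> f x = F) \<and> (F \<le> x \<longrightarrow> f x \<le> x)" if "x \<in> {0<..<1}" for x
  proof (cases "x \<le> a")
    case True
    then show ?thesis
      using f_le by simp
  next
    case False
    then show ?thesis
      using f_ge that F by simp
  qed
  moreover have "F \<in> {0<..1}"
    using F a by simp
  ultimately have "one_good f"
    unfolding one_good_def by blast
  then show "one_good (fix_all_but_one (beta_tcf \<beta>) k A l X)"
    unfolding f_def .
qed

end
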